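(* As formal power series in $q$: \begin{align*} U(\kappa) &= 5 \xi^3 - 20 \xi^4 + 16 \xi^5,\\ U(\xi) &= 5 \xi - 4 \xi^2,\\ U(\kappa^2) &= -\xi^5 + 50 \xi^6 - 400 \xi^7 + 1120 \xi^8 - 1280 \xi^9 + 512 \xi^{10},\\ U(\kappa\xi) &= 3 \xi^3 - 18 \xi^4 + 16 \xi^5,\\ U(\xi^2) &= -9 \xi + 58 \xi^2 - 80 \xi^3 + 32 \xi^4. \end{align*}
   Context: Let $E(q)=\prod_{m\ge1}(1-q^m)$. Define $$\gamma(q)=\frac{E(q)^5E(q^2)^5E(q^6)^5}{E(q^3)^{15}},\qquad \xi=\xi(q)=\frac{E(q^2)^5E(q^6)}{E(q)E(q^3)^5},\qquad \kappa=\kappa(q)=\frac{\gamma(q^2)^2}{\gamma(q)}.$$ $U$ is the operator on power series given by $U\left(\sum_n a_nq^n\right)=\sum_n a_{2n}q^n$. *)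

theory Defs
  imports "HOL-Computational_Algebra.Formal_Power_Series"
begin

text \<open>The Euler product E(q) = prod_{m>=1} (1 - q^m) as a formal power series:
  its n-th coefficient is the n-th coefficient of the finite product over m = 1..n
  (factors with m > n do not affect coefficient n).\<close>
definition Eul :: "rat fps" where
  "Eul = Abs_fps (\<lambda>n. fps_nth (\<Prod>m\<in>{1..n}. (1 - fps_X ^ m :: rat fps)) n)"

definition qsub :: "nat \<Rightarrow> rat fps \<Rightarrow> rat fps" where
  "qsub k f = f oo (fps_X ^ k)"

definition gam :: "rat fps" where
  "gam = Eul ^ 5 * (qsub 2 Eul) ^ 5 * (qsub 6 Eul) ^ 5 / (qsub 3 Eul) ^ 15"

definition xi :: "rat fps" where
  "xi = (qsub 2 Eul) ^ 5 * qsub 6 Eul / (Eul * (qsub 3 Eul) ^ 5)"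

definition kap :: "rat fps" where
  "kap = (qsub 2 gam) ^ 2 / gam"

definition Uop :: "rat fps \<Rightarrow> rat fps" where
  "Uop f = Abs_fps (\<lambda>n. fps_nth f (2 * n))"

end

theory Submission
  imports Defs
begin

text \<open>
  Write psi(q) = E(q^2)^2 / E(q), r(q) = psi(q^3)^2 / psi(q)^2 and w = q r(q^2), an odd power
  series. Everything reduces to the three identities
    xi(q) (1 + w)^2 = 1 + 3w,  xi(q^2) (1 - w^2) = 1,  kappa = xi(q^2)^5 (1 + w)^5.
  They exhibit kappa and xi as polynomials in w with coefficients that are series in q^2, so U
  just selects the even powers of w; with s = q r(q)^2 and xi (1 - s) = 1 the results are
  polynomials in xi. The three identities express 1 + w, 1 - w and 1 + 3w as eta quotients
  (2-dissections of E(q^3)^3/E(q) and E(q)^3/E(q^3)). Each of these follows by splitting a product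
  of two theta series according to the parity of m + n and applying the Jacobi triple product;
  for 1 + 3w the theta series carry a primitive cube root of unity, which is why complex
  coefficients appear.
\<close>

section \<open>Infinite products and sums of monomials\<close>

text \<open>Coefficient \<open>n\<close> of a product involves only the coefficients up to
  \<open>n\<close> of the factors, and finitely many coefficients are eventually constant
  together.\<close>

lemma tendsto_mult_fps:
  fixes f g :: "'b \<Rightarrow> 'a::ring fps"
  assumes "(f \<longlongrightarrow> a) F" "(g \<longlongrightarrow> b) F"
  shows "((\<lambda>x. f x * g x) \<longlongrightarrow> a * b) F"
proof (rule tendsto_fpsI)
  fix n
  have "\<forall>\<^sub>F x in F. \<forall>i\<in>{0..n}. fps_nth (f x) i = fps_nth a i"
    and "\<forall>\<^sub>F x in F. \<forall>i\<in>{0..n}. fps_nth (g x) i = fps_nth b i"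
    using assms unfolding tendsto_fps_iff by (auto intro: eventually_ball_finite)
  then show "\<forall>\<^sub>F x in F. fps_nth (f x * g x) n = fps_nth (a * b) n"
    by eventually_elim (auto simp: fps_mult_nth intro!: sum.cong)
qed

text \<open>The q-Pochhammer symbol (c q^k; q^d)_n. The constant c lets signs and cube roots of
  unity enter.\<close>

definition qpoch :: "'a::field \<Rightarrow> nat \<Rightarrow> nat \<Rightarrow> nat \<Rightarrow> 'a fps" where
  "qpoch c k d n = (\<Prod>i<n. 1 - fps_const c * fps_X ^ (k + d * i))"

text \<open>With \<open>Suc n\<close> factors the first omitted exponent is at least
  \<open>n + 1\<close> whenever \<open>d > 0\<close>, even for \<open>k = 0\<close>.\<close>

definition qpoch_inf :: "'a::field \<Rightarrow> nat \<Rightarrow> nat \<Rightarrow> 'a fps" where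
  "qpoch_inf c k d = Abs_fps (\<lambda>n. fps_nth (qpoch c k d (Suc n)) n)"

lemma qpoch_Suc: "qpoch c k d (Suc n) = qpoch c k d n * (1 - fps_const c * fps_X ^ (k + d * n))"
  by (simp add: qpoch_def)

text \<open>Each factor added after the first \<open>n\<close> alters only coefficients of degree at
  least \<open>k + d * n\<close>.\<close>

lemma qpoch_nth_stable:
  assumes "m < k + d * n" "n \<le> n'"
  shows "fps_nth (qpoch c k d n') m = fps_nth (qpoch c k d n) m"
  using assms(2)
proof (induction n' rule: dec_induct)
  case (step j)
  have "m < k + d * j"
    using assms(1) step.hyps(1) by (meson add_left_mono less_le_trans mult_le_mono2)
  have "qpoch c k d (Suc j) =
      qpoch c k d j - fps_const c * (qpoch c k d j * fps_X ^ (k + d * j))"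
    by (simp add: qpoch_Suc algebra_simps)
  then have "fps_nth (qpoch c k d (Suc j)) m = fps_nth (qpoch c k d j) m"
    using \<open>m < k + d * j\<close> by (simp add: fps_X_power_mult_right_nth)
  with step.IH show ?case by simp
qed simp

lemma qpoch_inf_nth:
  assumes "d > 0" "m < k + d * n"
  shows "fps_nth (qpoch_inf c k d) m = fps_nth (qpoch c k d n) m"
proof -
  have "m < k + d * Suc m"
    using assms(1) by (cases d) auto
  then show ?thesis
    unfolding qpoch_inf_def using assms(2)
    by (simp del: mult_Suc_right)
       (metis le_cases qpoch_nth_stable)
qed

lemma qpoch_tendsto:
  assumes "d > 0"
  shows "qpoch c k d \<longlonglongrightarrow> qpoch_inf c k d"
proof (rule tendsto_fpsI)
  fix m
  show "\<forall>\<^sub>F n in sequentially. fps_nth (qpoch c k d n) m = fps_nth (qpoch_inf c k d) m"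
    using eventually_gt_at_top[of m]
  proof eventually_elim
    case (elim n)
    then have "m < k + d * n"
      using assms by (cases d) auto
    with assms show ?case by (simp add: qpoch_inf_nth)
  qed
qed

lemma qpoch_split2: "qpoch c k d (2 * n) = qpoch c k (2 * d) n * qpoch c (k + d) (2 * d) n"
  by (induction n) (simp_all add: qpoch_Suc qpoch_def algebra_simps)

lemma qpoch_split3: "qpoch c k d (3 * n) =
    qpoch c k (3 * d) n * qpoch c (k + d) (3 * d) n * qpoch c (k + 2 * d) (3 * d) n"
proof (induction n)
  case (Suc n)
  have "3 * Suc n = Suc (Suc (Suc (3 * n)))" by simp
  then show ?case
    by (simp add: qpoch_Suc Suc del: mult_Suc_right) (simp add: algebra_simps)
qed (simp add: qpoch_def)

lemma fps_const_X_power_mult: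
  "(fps_const a * fps_X ^ i) * (fps_const b * fps_X ^ j) =
    (fps_const (a * b) * fps_X ^ (i + j) :: 'a::field fps)"
  by (simp add: power_add fps_const_mult[symmetric] mult_ac del: fps_const_mult)

lemma qpoch_neg: "qpoch c k d n * qpoch (-c) k d n = qpoch (c^2) (2 * k) (2 * d) n"
proof -
  have *: "(1 - fps_const c * fps_X ^ e) * (1 - fps_const (-c) * fps_X ^ e) =
      1 - fps_const (c^2) * fps_X ^ (2 * e)" for e
    using fps_const_X_power_mult[of c e c e]
    by (simp add: algebra_simps power2_eq_square mult_2 fps_const_neg[symmetric] del: fps_const_neg)
  show ?thesis
    unfolding qpoch_def prod.distrib[symmetric] * by (simp add: algebra_simps)
qed

text \<open>Factor by factor this is (1 - Y)(1 - w Y)(1 - w^2 Y) = 1 - Y^3 with Y a power of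
  \<open>fps_X\<close>.\<close>

lemma qpoch_cube_roots:
  fixes w :: "'a::field"
  assumes "1 + w + w^2 = 0"
  shows "qpoch 1 k d n * qpoch w k d n * qpoch (w^2) k d n = qpoch 1 (3 * k) (3 * d) n"
proof -
  define W :: "'a fps" where "W = fps_const w"
  have "1 + W + W^2 = fps_const (1 + w + w^2)"
    by (simp add: W_def fps_const_power flip: fps_const_add)
  with assms have W: "1 + W + W^2 = 0" by simp
  have "(1 - Y) * (1 - W * Y) * (1 - W^2 * Y) = 1 - Y ^ 3" for Y :: "'a fps"
    using W by algebra
  then have *: "(1 - fps_const 1 * fps_X ^ e) * (1 - fps_const w * fps_X ^ e) *
      (1 - fps_const (w^2) * fps_X ^ e) = 1 - fps_const 1 * fps_X ^ (3 * e)" for e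
    by (simp add: W_def fps_const_power power_mult mult.commute[of 3])
  show ?thesis
    unfolding qpoch_def prod.distrib[symmetric] * by (simp add: algebra_simps)
qed

text \<open>Both sides are limits of the finite splitting, the left one along the subsequence of
  even lengths.\<close>

lemma qpoch_inf_split2:
  assumes "d > 0"
  shows "qpoch_inf c k d = qpoch_inf c k (2 * d) * qpoch_inf c (k + d) (2 * d)"
proof (rule LIMSEQ_unique)
  have "filterlim (\<lambda>n::nat. 2 * n) at_top at_top"
    by (rule mult_nat_left_at_top) simp
  from filterlim_compose[OF qpoch_tendsto[OF assms] this]
  show "(\<lambda>n. qpoch c k d (2 * n)) \<longlonglongrightarrow> qpoch_inf c k d" .
  show "(\<lambda>n. qpoch c k d (2 * n)) \<longlonglongrightarrow> qpoch_inf c k (2 * d) * qpoch_inf c (k + d) (2 * d)"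
    unfolding qpoch_split2 using assms by (intro tendsto_mult_fps qpoch_tendsto) auto
qed

lemma qpoch_inf_split3:
  assumes "d > 0"
  shows "qpoch_inf c k d =
    qpoch_inf c k (3 * d) * qpoch_inf c (k + d) (3 * d) * qpoch_inf c (k + 2 * d) (3 * d)"
proof (rule LIMSEQ_unique)
  have "filterlim (\<lambda>n::nat. 3 * n) at_top at_top"
    by (rule mult_nat_left_at_top) simp
  from filterlim_compose[OF qpoch_tendsto[OF assms] this]
  show "(\<lambda>n. qpoch c k d (3 * n)) \<longlonglongrightarrow> qpoch_inf c k d" .
  show "(\<lambda>n. qpoch c k d (3 * n)) \<longlonglongrightarrow>
      qpoch_inf c k (3 * d) * qpoch_inf c (k + d) (3 * d) * qpoch_inf c (k + 2 * d) (3 * d)"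
    unfolding qpoch_split3 using assms by (intro tendsto_mult_fps qpoch_tendsto) auto
qed

lemma qpoch_inf_neg:
  assumes "d > 0"
  shows "qpoch_inf c k d * qpoch_inf (-c) k d = qpoch_inf (c^2) (2 * k) (2 * d)"
proof (rule LIMSEQ_unique)
  show "qpoch (c^2) (2 * k) (2 * d) \<longlonglongrightarrow> qpoch_inf c k d * qpoch_inf (-c) k d"
    unfolding qpoch_neg[symmetric, abs_def] using assms by (intro tendsto_mult_fps qpoch_tendsto) auto
qed (use assms in \<open>auto intro: qpoch_tendsto\<close>)

lemma qpoch_inf_cube_roots:
  assumes "1 + w + w^2 = (0::'a::field)" "d > 0"
  shows "qpoch_inf 1 k d * qpoch_inf w k d * qpoch_inf (w^2) k d = qpoch_inf 1 (3 * k) (3 * d)"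
proof (rule LIMSEQ_unique)
  show "qpoch 1 (3 * k) (3 * d) \<longlonglongrightarrow> qpoch_inf 1 k d * qpoch_inf w k d * qpoch_inf (w^2) k d"
    unfolding qpoch_cube_roots[OF assms(1), symmetric, abs_def]
    using assms by (intro tendsto_mult_fps qpoch_tendsto) auto
qed (use assms in \<open>auto intro: qpoch_tendsto\<close>)

text \<open>The factor of index 0 is the constant 1 - c. This case arises from theta series whose
  linear and quadratic coefficients agree.\<close>

lemma qpoch_inf_0:
  assumes "d > 0"
  shows "qpoch_inf c 0 d = fps_const (1 - c) * qpoch_inf c d d"
proof (rule LIMSEQ_unique)
  have *: "qpoch c 0 d (Suc n) = fps_const (1 - c) * qpoch c d d n" for n
    unfolding qpoch_def by (subst prod.lessThan_Suc_shift) (simp add: fps_const_sub[symmetric] del: fps_const_sub)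
  show "(\<lambda>n. qpoch c 0 d (Suc n)) \<longlonglongrightarrow> qpoch_inf c 0 d"
    using qpoch_tendsto[OF assms] by (rule LIMSEQ_Suc)
  show "(\<lambda>n. qpoch c 0 d (Suc n)) \<longlonglongrightarrow> fps_const (1 - c) * qpoch_inf c d d"
    unfolding * using assms by (intro tendsto_mult_fps qpoch_tendsto tendsto_const) auto
qed

lemma qpoch_inf_neq_0:
  assumes "k > 0" "d > 0"
  shows "qpoch_inf c k d \<noteq> 0"
proof -
  have "fps_nth (qpoch_inf c k d) 0 = fps_nth (qpoch c k d 0) 0"
    using assms by (intro qpoch_inf_nth) auto
  then show ?thesis by (auto simp: qpoch_def)
qed

section \<open>Series of weighted monomials over an index set\<close>

definition wsum :: "'i set \<Rightarrow> ('i \<Rightarrow> nat) \<Rightarrow> ('i \<Rightarrow> 'a::field) \<Rightarrow> 'a fps" where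
  "wsum A e c = Abs_fps (\<lambda>N. \<Sum>i | i \<in> A \<and> e i = N. c i)"

text \<open>The Cauchy product groups pairs by total exponent. Finite fibres matter because a sum
  over an infinite set is 0 by convention, so that \<open>wsum\<close> is the intended series only
  when the fibres are finite.\<close>

lemma wsum_mult:
  assumes "\<And>N. finite {i \<in> A. e i = N}" "\<And>N. finite {i \<in> B. f i = N}"
  shows "wsum A e c * wsum B f d =
    wsum (A \<times> B) (\<lambda>(i, j). e i + f j) (\<lambda>(i, j). c i * d j)"
proof (rule fps_ext)
  fix N
  have "fps_nth (wsum A e c * wsum B f d) N =
      (\<Sum>n=0..N. \<Sum>p\<in>{i \<in> A. e i = n} \<times> {j \<in> B. f j = N - n}. c (fst p) * d (snd p))"
    by (simp add: wsum_def fps_mult_nth sum_product sum.cartesian_product case_prod_unfold)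
  also have "\<dots> = (\<Sum>p\<in>(\<Union>n\<in>{0..N}. {i \<in> A. e i = n} \<times> {j \<in> B. f j = N - n}). c (fst p) * d (snd p))"
    by (rule sum.UNION_disjoint[symmetric]) (use assms in auto)
  also have "(\<Union>n\<in>{0..N}. {i \<in> A. e i = n} \<times> {j \<in> B. f j = N - n}) =
      {p. p \<in> A \<times> B \<and> (case p of (i, j) \<Rightarrow> e i + f j) = N}"
    by auto
  finally show "fps_nth (wsum A e c * wsum B f d) N =
      fps_nth (wsum (A \<times> B) (\<lambda>(i, j). e i + f j) (\<lambda>(i, j). c i * d j)) N"
    by (simp add: wsum_def case_prod_unfold)
qed

lemma wsum_Un:
  assumes "\<And>N. finite {i \<in> A \<union> B. e i = N}" "A \<inter> B = {}"
  shows "wsum (A \<union> B) e c = wsum A e c + wsum B e c"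
proof (rule fps_ext)
  fix N
  have "{i. i \<in> A \<union> B \<and> e i = N} = {i \<in> A. e i = N} \<union> {i \<in> B. e i = N}" by auto
  moreover have "finite {i \<in> A. e i = N}" "finite {i \<in> B. e i = N}"
    by (rule finite_subset[OF _ assms(1)[of N]]; auto)+
  ultimately show "fps_nth (wsum (A \<union> B) e c) N = fps_nth (wsum A e c + wsum B e c) N"
    unfolding wsum_def using assms(2) by (simp, subst sum.union_disjoint) auto
qed

lemma wsum_reindex:
  assumes "bij_betw h B A"
    and "\<And>i. i \<in> B \<Longrightarrow> e (h i) = e' i" "\<And>i. i \<in> B \<Longrightarrow> c (h i) = c' i"
  shows "wsum A e c = wsum B e' c'"
proof -
  have "(\<Sum>i | i \<in> A \<and> e i = N. c i) = (\<Sum>i | i \<in> B \<and> e' i = N. c' i)" for N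
  proof -
    have "bij_betw h {i \<in> B. e' i = N} {i \<in> A. e i = N}"
      using assms(1,2) unfolding bij_betw_def by (auto simp: inj_on_def image_iff)
    then have "(\<Sum>i | i \<in> A \<and> e i = N. c i) = (\<Sum>i | i \<in> B \<and> e' i = N. c (h i))"
      by (rule sum.reindex_bij_betw[symmetric])
    also have "\<dots> = (\<Sum>i | i \<in> B \<and> e' i = N. c' i)"
      by (rule sum.cong) (simp_all add: assms(3))
    finally show ?thesis .
  qed
  then show ?thesis by (simp add: wsum_def)
qed

lemma wsum_shift: "fps_const a * fps_X ^ k * wsum A e c = wsum A (\<lambda>i. k + e i) (\<lambda>i. a * c i)"
proof (rule fps_ext)
  fix N
  have "{i. i \<in> A \<and> k + e i = N} = (if N < k then {} else {i \<in> A. e i = N - k})" by auto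
  then show "fps_nth (fps_const a * fps_X ^ k * wsum A e c) N =
      fps_nth (wsum A (\<lambda>i. k + e i) (\<lambda>i. a * c i)) N"
    by (simp add: wsum_def mult.assoc fps_X_power_mult_nth sum_distrib_left)
qed

section \<open>Products of two theta series\<close>

text \<open>For a > 0 and |b| <= a all exponents are nonnegative, so \<open>nat\<close> truncates
  nothing.\<close>

definition theta :: "'a::field \<Rightarrow> int \<Rightarrow> int \<Rightarrow> 'a fps" where
  "theta c a b = wsum UNIV (\<lambda>n::int. nat (a * n^2 + b * n)) (\<lambda>n. c powi n)"

text \<open>The chain is a n^2 + b n >= a (n^2 - |n|) >= n^2 - |n| >= |n| - 1. The linear growth
  makes the fibres of the exponent finite.\<close>

lemma theta_exponent_ge:
  fixes a b n :: int
  assumes "a > 0" "\<bar>b\<bar> \<le> a"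
  shows "\<bar>n\<bar> - 1 \<le> a * n^2 + b * n" "0 \<le> a * n^2 + b * n"
proof -
  have "\<bar>b * n\<bar> \<le> a * \<bar>n\<bar>"
    using assms by (simp add: abs_mult mult_right_mono)
  then have 1: "a * (n^2 - \<bar>n\<bar>) \<le> a * n^2 + b * n"
    by (simp add: right_diff_distrib)
  have "\<bar>n\<bar> \<le> n^2"
    by (metis abs_ge_zero mult_left_mono mult_1_right abs_0 power2_abs power2_eq_square
        zero_less_abs_iff int_one_le_iff_zero_less mult_zero_left order_refl)
  then have 2: "n^2 - \<bar>n\<bar> \<le> a * (n^2 - \<bar>n\<bar>)"
    using assms mult_right_mono[of 1 a "n^2 - \<bar>n\<bar>"] by simp
  have "0 \<le> (\<bar>n\<bar> - 1)^2" by simp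
  also have "\<dots> = n^2 - \<bar>n\<bar> - (\<bar>n\<bar> - 1)"
    by (simp add: power2_diff)
  finally show "\<bar>n\<bar> - 1 \<le> a * n^2 + b * n"
    using 1 2 by linarith
  show "0 \<le> a * n^2 + b * n"
    using 1 2 \<open>\<bar>n\<bar> \<le> n^2\<close> by linarith
qed

lemma finite_theta_fibre:
  fixes a b :: int
  assumes "a > 0" "\<bar>b\<bar> \<le> a"
  shows "finite {n. nat (a * n^2 + b * n) = N}"
proof (rule finite_subset)
  show "{n. nat (a * n^2 + b * n) = N} \<subseteq> {- int N - 1..int N + 1}"
  proof clarify
    fix n assume "N = nat (a * n^2 + b * n)"
    then show "n \<in> {- int (nat (a * n^2 + b * n)) - 1..int (nat (a * n^2 + b * n)) + 1}"
      using theta_exponent_ge[OF assms, of n] by auto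
  qed
qed simp

lemma theta_mult_theta:
  assumes "a > 0" "\<bar>b\<bar> \<le> a" "\<bar>b'\<bar> \<le> a"
  shows "theta c a b * theta c' a b' =
    wsum UNIV (\<lambda>(m, n). nat (a * (m^2 + n^2) + b * m + b' * n)) (\<lambda>(m, n). c powi m * c' powi n)"
proof -
  have "nat (a * m^2 + b * m) + nat (a * n^2 + b' * n) = nat (a * (m^2 + n^2) + b * m + b' * n)"
    for m n
    using theta_exponent_ge(2)[OF assms(1,2), of m] theta_exponent_ge(2)[OF assms(1,3), of n]
    by (simp add: nat_add_distrib[symmetric] algebra_simps)
  then show ?thesis
    unfolding theta_def
    by (subst wsum_mult) (use finite_theta_fibre assms in auto)
qed

text \<open>The double sum over (m, n) is split by the parity of m + n. On each half a linear
  substitution diagonalises the exponent, so the half factors into two theta series again. The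
  bounds on b and b' keep all new linear coefficients between -2a and 2a.\<close>

lemma theta_mult:
  fixes c c' :: "'a::field"
  assumes "0 < a" "0 \<le> b + b'" "b \<le> b'" "b' \<le> a" and c: "c \<noteq> 0" "c' \<noteq> 0"
  shows "theta c a b * theta c' a b' =
    theta (c * c') (2 * a) (b + b') * theta (c / c') (2 * a) (b - b') +
    fps_const (1 / c') * fps_X ^ nat (a - b') *
      (theta (1 / (c * c')) (2 * a) (2 * a - b - b') * theta (c / c') (2 * a) (2 * a + b - b'))"
proof -
  define e where "e = (\<lambda>(m, n). nat (a * (m^2 + n^2) + b * m + b' * n))"
  define w where "w = (\<lambda>(m, n). c powi m * c' powi n)"
  define A where "A = {(m, n::int). even (m + n)}"
  define B where "B = {(m, n::int). odd (m + n)}"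
  \<comment> \<open>\<open>f\<close> parametrises the pairs with even sum and \<open>g\<close> those
    with odd sum. The -1 in \<open>g\<close> produces the constant exponent \<open>a - b'\<close>
    and the prefactor \<open>1 / c'\<close>.\<close>
  define f where "f = (\<lambda>(s, t::int). (s + t, s - t))"
  define g where "g = (\<lambda>(s, t::int). (t - s, - 1 - s - t))"
  have bounds: "\<bar>b\<bar> \<le> a" "\<bar>b'\<bar> \<le> a" using assms by auto
  have powi_diff: "x powi (i - j) = x powi i / x powi j" if "x \<noteq> 0" for x :: 'a and i j
    using that by (simp add: power_int_diff)
  have f: "bij_betw f UNIV A"
    by (rule bij_betw_byWitness[of _ "\<lambda>(m, n). ((m + n) div 2, (m - n) div 2)"])
      (auto simp: f_def A_def; presburger)+
  have g: "bij_betw g UNIV B"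
    by (rule bij_betw_byWitness[of _ "\<lambda>(m, n). ((- 1 - m - n) div 2, (m - n - 1) div 2)"])
      (auto simp: g_def B_def; presburger)+
  have fin: "finite {i. e i = N}" for N
  proof (rule finite_subset)
    show "{i. e i = N} \<subseteq> {- int N - 1..int N + 1} \<times> {- int N - 1..int N + 1}"
    proof
      fix i assume "i \<in> {i. e i = N}"
      moreover obtain m n where i: "i = (m, n)" by force
      ultimately have "e (m, n) = N" by simp
      then have "(a * m^2 + b * m) + (a * n^2 + b' * n) \<le> int N"
        by (auto simp: e_def algebra_simps)
      then show "i \<in> {- int N - 1..int N + 1} \<times> {- int N - 1..int N + 1}"
        unfolding i
        using theta_exponent_ge[OF assms(1) bounds(1), of m]
          theta_exponent_ge[OF assms(1) bounds(2), of n] by auto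
    qed
  qed simp
  have "theta c a b * theta c' a b' = wsum (A \<union> B) e w"
    using assms bounds unfolding e_def w_def
    by (subst theta_mult_theta) (auto simp: A_def B_def intro!: arg_cong[of _ _ "\<lambda>S. wsum S _ _"])
  also have "\<dots> = wsum A e w + wsum B e w"
    by (rule wsum_Un) (auto simp: A_def B_def intro: finite_subset[OF _ fin])
  also have "wsum A e w = theta (c * c') (2 * a) (b + b') * theta (c / c') (2 * a) (b - b')"
  proof (subst theta_mult_theta, (use assms in auto)[3], rule wsum_reindex[OF f])
    fix i :: "int \<times> int"
    obtain s t where i: "i = (s, t)" by force
    show "e (f i) = (case i of (s, t) \<Rightarrow>
        nat (2 * a * (s^2 + t^2) + (b + b') * s + (b - b') * t))"
      by (auto simp: e_def f_def i power2_eq_square algebra_simps intro!: arg_cong[of _ _ nat])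
    show "w (f i) = (case i of (s, t) \<Rightarrow> (c * c') powi s * (c / c') powi t)"
      using c by (simp add: i w_def f_def power_int_mult_distrib power_int_divide_distrib
          power_int_add powi_diff field_simps)
  qed
  also have "wsum B e w = fps_const (1 / c') * fps_X ^ nat (a - b') *
      (theta (1 / (c * c')) (2 * a) (2 * a - b - b') * theta (c / c') (2 * a) (2 * a + b - b'))"
  proof (subst theta_mult_theta, (use assms in auto)[3], unfold wsum_shift, rule wsum_reindex[OF g])
    fix i :: "int \<times> int"
    obtain s t where i: "i = (s, t)" by force
    have "0 \<le> (2 * a * s^2 + (2 * a - b - b') * s)" "0 \<le> (2 * a * t^2 + (2 * a + b - b') * t)"
      using assms by (auto intro!: theta_exponent_ge(2))
    then have "nat (a - b') + nat (2 * a * (s^2 + t^2) + (2 * a - b - b') * s + (2 * a + b - b') * t) =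
        nat ((a - b') + (2 * a * (s^2 + t^2) + (2 * a - b - b') * s + (2 * a + b - b') * t))"
      using assms by (intro nat_add_distrib[symmetric]) (auto simp: algebra_simps)
    also have "\<dots> = e (g i)"
      by (auto simp: e_def g_def i power2_eq_square algebra_simps intro!: arg_cong[of _ _ nat])
    finally show "e (g i) = nat (a - b') + (case i of (s, t) \<Rightarrow>
        nat (2 * a * (s^2 + t^2) + (2 * a - b - b') * s + (2 * a + b - b') * t))"
      by (simp add: i)
    show "w (g i) = 1 / c' * (case i of (s, t) \<Rightarrow> (1 / (c * c')) powi s * (c / c') powi t)"
      using c by (simp add: i w_def g_def power_int_mult_distrib power_int_divide_distrib
          power_int_add powi_diff power_int_minus field_simps)
  qed
  finally show ?thesis .
qed

section \<open>The Jacobi triple product\<close>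

text \<open>The convention 1/(q; q)_n = 0 for n < 0 makes Gaussian binomials vanish outside their
  range.\<close>

definition qpoch_recip :: "nat \<Rightarrow> int \<Rightarrow> 'a::field fps" where
  "qpoch_recip d n = (if n < 0 then 0 else inverse (qpoch 1 d d (nat n)))"

lemma qpoch_nth_0: "k > 0 \<Longrightarrow> fps_nth (qpoch c k d n) 0 = 1"
  by (induction n) (simp_all add: qpoch_def)

text \<open>At n = 0 the factor 1 - \<open>fps_X ^ 0\<close> is 0, in agreement with the value 0 at
  -1.\<close>

lemma qpoch_recip_pred:
  assumes "d > 0" "n \<ge> 0"
  shows "qpoch_recip d (n - 1) = qpoch_recip d n * (1 - fps_X ^ (d * nat n) :: 'a::field fps)"
proof (cases "n = 0")
  case False
  with assms obtain m where n: "n = int (Suc m)"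
    by (metis int_nat_eq not0_implies_Suc of_nat_0)
  define P :: "'a fps" where "P = qpoch 1 d d m"
  define Q :: "'a fps" where "Q = 1 - fps_X ^ (d * Suc m)"
  have "fps_nth P 0 = 1" "fps_nth Q 0 = 1"
    using assms by (simp_all add: P_def Q_def qpoch_nth_0)
  then have "inverse P = inverse (P * Q) * Q"
    by (simp add: fps_inverse_mult mult.assoc inverse_mult_eq_1)
  also have "P * Q = qpoch 1 d d (Suc m)"
    by (simp add: P_def Q_def qpoch_Suc)
  finally show ?thesis
    by (simp add: n qpoch_recip_def P_def Q_def nat_add_distrib)
qed (simp add: qpoch_recip_def)

text \<open>The Gaussian binomial coefficient [2N choose N + k] in base q^d.\<close>

definition jacobi_coeff :: "nat \<Rightarrow> nat \<Rightarrow> int \<Rightarrow> 'a::field fps" where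
  "jacobi_coeff d N k =
     qpoch 1 d d (2 * N) * qpoch_recip d (int N - k) * qpoch_recip d (int N + k)"

lemma jacobi_coeff_eq_0: "\<bar>k\<bar> > int N \<Longrightarrow> jacobi_coeff d N k = 0"
  by (auto simp: jacobi_coeff_def qpoch_recip_def)

text \<open>Two q-Pascal steps at once, from 2N to 2N + 2. This is the recurrence that two new
  factors of the finite triple product impose on its coefficients.\<close>

lemma jacobi_coeff_Suc:
  assumes "d > 0" "\<bar>k\<bar> \<le> int (Suc N)"
  shows "jacobi_coeff d (Suc N) k =
    (1 + fps_X ^ (d * (2 * N + 1))) * jacobi_coeff d N k +
    fps_X ^ (d * nat (int N - k + 1)) * jacobi_coeff d N (k - 1) +
    fps_X ^ (d * nat (int N + k + 1)) * (jacobi_coeff d N (k + 1) :: 'a::field fps)"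
proof -
  \<comment> \<open>All reciprocals are expressed through \<open>R\<close> and \<open>S\<close>,
    those of largest index; i + j = 2N + 2 then links \<open>x\<close> and \<open>y\<close> to
    \<open>z\<close>.\<close>
  define i j where "i = nat (int N - k + 1)" and "j = nat (int N + k + 1)"
  have ij: "int i = int N - k + 1" "int j = int N + k + 1"
    using assms by (auto simp: i_def j_def)
  define x y z :: "'a fps" where "x = fps_X ^ (d * i)" and "y = fps_X ^ (d * j)"
    and "z = fps_X ^ (d * (2 * N + 1))"
  define R S :: "'a fps" where "R = qpoch_recip d (int i)" and "S = qpoch_recip d (int j)"
  define G :: "'a fps" where "G = qpoch 1 d d (2 * N)"
  have sum: "i + j = 2 * N + 2" using ij by linarith
  have R1: "qpoch_recip d (int i - 1) = R * (1 - x)"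
    unfolding R_def x_def using assms by (subst qpoch_recip_pred) auto
  have S1: "qpoch_recip d (int j - 1) = S * (1 - y)"
    unfolding S_def y_def using assms by (subst qpoch_recip_pred) auto
  \<comment> \<open>One more step down vanishes at 0 on both sides, whatever the truncated exponent is.\<close>
  have R2: "qpoch_recip d (int i - 2) = R * (1 - x) * (1 - fps_X ^ (d * (i - 1)))"
  proof (cases "i = 0")
    case False
    then have "qpoch_recip d (int i - 1 - 1) =
        qpoch_recip d (int i - 1) * (1 - fps_X ^ (d * nat (int i - 1)) :: 'a fps)"
      using assms by (intro qpoch_recip_pred) auto
    moreover have "nat (int i - 1) = i - 1" by simp
    ultimately show ?thesis using R1 by simp
  qed (simp add: qpoch_recip_def x_def)
  have S2: "qpoch_recip d (int j - 2) = S * (1 - y) * (1 - fps_X ^ (d * (j - 1)))"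
  proof (cases "j = 0")
    case False
    then have "qpoch_recip d (int j - 1 - 1) =
        qpoch_recip d (int j - 1) * (1 - fps_X ^ (d * nat (int j - 1)) :: 'a fps)"
      using assms by (intro qpoch_recip_pred) auto
    moreover have "nat (int j - 1) = j - 1" by simp
    ultimately show ?thesis using S1 by simp
  qed (simp add: qpoch_recip_def y_def)
  \<comment> \<open>At j = 0 the truncated \<open>j - 1\<close> gives a wrong exponent, but 1 - y =
    0 annihilates both sides.\<close>
  have z1: "x * ((1 - y) * fps_X ^ (d * (j - 1))) = (1 - y) * z"
  proof (cases "j = 0")
    case False
    then have "d * i + d * (j - 1) = d * (2 * N + 1)"
      using sum by (metis Suc_1 add_Suc_right add_diff_assoc diff_Suc_1 distrib_left
          less_one not_le plus_1_eq_Suc add.commute)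
    then have "x * fps_X ^ (d * (j - 1)) = z"
      unfolding x_def z_def by (simp flip: power_add)
    then show ?thesis by (simp add: mult_ac)
  qed (simp add: y_def)
  have z2: "y * ((1 - x) * fps_X ^ (d * (i - 1))) = (1 - x) * z"
  proof (cases "i = 0")
    case False
    then have "d * j + d * (i - 1) = d * (2 * N + 1)"
      using sum by (metis Suc_1 add_Suc_right add_diff_assoc diff_Suc_1 distrib_left
          less_one not_le plus_1_eq_Suc add.commute)
    then have "y * fps_X ^ (d * (i - 1)) = z"
      unfolding y_def z_def by (simp flip: power_add)
    then show ?thesis by (simp add: mult_ac)
  qed (simp add: x_def)
  have xy: "fps_X ^ (d * (2 * N + 2)) = x * y"
    unfolding x_def y_def sum[symmetric] by (simp add: power_add distrib_left)
  have "qpoch 1 d d (2 * Suc N) = G * (1 - z) * (1 - fps_X ^ (d * (2 * N + 2)))"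
    by (simp add: qpoch_Suc G_def z_def algebra_simps)
  moreover have "int (Suc N) - k = int i" "int (Suc N) + k = int j"
    using ij by auto
  ultimately have "jacobi_coeff d (Suc N) k = G * (1 - z) * (1 - x * y) * R * S"
    unfolding jacobi_coeff_def R_def S_def xy by (simp only:)
  also have "\<dots> = (1 + z) * (G * (R * (1 - x)) * (S * (1 - y))) +
      x * (G * R * (S * (1 - y) * (1 - fps_X ^ (d * (j - 1))))) +
      y * (G * (R * (1 - x) * (1 - fps_X ^ (d * (i - 1)))) * S)"
  proof -
    \<comment> \<open>Apart from the factor \<open>G * R * S\<close> this says (1 - z)(1 - xy) = (1
      + z)(1 - x)(1 - y) + (1 - y)(x - z) + (1 - x)(y - z).\<close>
    have "G * (1 - z) * (1 - x * y) * R * S = (1 + z) * (G * (R * (1 - x)) * (S * (1 - y))) +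
        x * (G * R * (S * (1 - y) * (1 - p))) + y * (G * (R * (1 - x) * (1 - q)) * S)"
      if "x * ((1 - y) * p) = (1 - y) * z" "y * ((1 - x) * q) = (1 - x) * z" for p q
      using that by algebra
    from this[OF z1 z2] show ?thesis .
  qed
  also have "G * (R * (1 - x)) * (S * (1 - y)) = jacobi_coeff d N k"
    unfolding jacobi_coeff_def R1[symmetric] S1[symmetric] ij G_def by (simp add: algebra_simps)
  also have "G * R * (S * (1 - y) * (1 - fps_X ^ (d * (j - 1)))) = jacobi_coeff d N (k - 1)"
    unfolding jacobi_coeff_def S2[symmetric] R_def ij G_def by (simp add: algebra_simps)
  also have "G * (R * (1 - x) * (1 - fps_X ^ (d * (i - 1)))) * S = jacobi_coeff d N (k + 1)"
    unfolding jacobi_coeff_def R2[symmetric] S_def ij G_def by (simp add: algebra_simps)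
  finally show ?thesis
    unfolding x_def y_def z_def i_def j_def .
qed

text \<open>Induction on N. The new factors are 1 + u and 1 + v, where u moves the k-th monomial to
  the next one and v to the previous one, up to a power of q; collecting terms yields
  \<open>jacobi_coeff_Suc\<close>.\<close>

lemma finite_jacobi_triple_product:
  fixes c :: "'a::field" and a b :: int
  assumes "a > 0" "\<bar>b\<bar> \<le> a" "c \<noteq> 0"
  shows "qpoch (-c) (nat (a + b)) (nat (2 * a)) N * qpoch (- inverse c) (nat (a - b)) (nat (2 * a)) N =
    (\<Sum>k\<in>{- int N..int N}. jacobi_coeff (nat (2 * a)) N k *
      (fps_const (c powi k) * fps_X ^ nat (a * k^2 + b * k)))"
proof (induction N)
  case 0
  then show ?case by (simp add: qpoch_def jacobi_coeff_def qpoch_recip_def)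
next
  case (Suc N)
  define d where "d = nat (2 * a)"
  define f :: "int \<Rightarrow> 'a fps" where
    "f = (\<lambda>k. fps_const (c powi k) * fps_X ^ nat (a * k^2 + b * k))"
  define J :: "int \<Rightarrow> 'a fps" where "J = jacobi_coeff d N"
  define u v :: "'a fps" where "u = fps_const c * fps_X ^ (nat (a + b) + d * N)"
    and "v = fps_const (inverse c) * fps_X ^ (nat (a - b) + d * N)"
  have d: "d > 0" "int d = 2 * a" using assms by (auto simp: d_def)
  have exps: "0 \<le> a * k^2 + b * k" for k
    using assms(1,2) by (rule theta_exponent_ge(2))
  have J0: "J k = 0" if "k \<notin> {- int N..int N}" for k
    unfolding J_def using that by (intro jacobi_coeff_eq_0) auto
  \<comment> \<open>The exponents agree for |k| <= N; beyond that range
    \<open>nat (int N - k)\<close> may be truncated, but \<open>J k\<close> is 0.\<close>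
  have uf: "u * (J k * f k) = fps_X ^ (d * nat (int N - k)) * J k * f (k + 1)" for k
  proof (cases "k \<in> {- int N..int N}")
    case True
    then have "int (nat (a + b) + d * N + nat (a * k^2 + b * k)) =
        int (d * nat (int N - k) + nat (a * (k + 1)^2 + b * (k + 1)))"
      using assms exps[of k] exps[of "k + 1"] d by (simp add: algebra_simps power2_eq_square)
    then have "nat (a + b) + d * N + nat (a * k^2 + b * k) =
        d * nat (int N - k) + nat (a * (k + 1)^2 + b * (k + 1))"
      by linarith
    then have "u * f k = fps_X ^ (d * nat (int N - k)) * f (k + 1)"
      unfolding u_def f_def fps_const_X_power_mult
      using assms by (simp add: power_add power_int_add mult_ac)
    then show ?thesis by (simp add: mult_ac)
  qed (simp add: J0)
  have vf: "v * (J k * f k) = fps_X ^ (d * nat (int N + k)) * J k * f (k - 1)" for k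
  proof (cases "k \<in> {- int N..int N}")
    case True
    then have "int (nat (a - b) + d * N + nat (a * k^2 + b * k)) =
        int (d * nat (int N + k) + nat (a * (k - 1)^2 + b * (k - 1)))"
      using assms exps[of k] exps[of "k - 1"] d by (simp add: algebra_simps power2_eq_square)
    then have "nat (a - b) + d * N + nat (a * k^2 + b * k) =
        d * nat (int N + k) + nat (a * (k - 1)^2 + b * (k - 1))"
      by linarith
    then have "v * f k = fps_X ^ (d * nat (int N + k)) * f (k - 1)"
      unfolding v_def f_def fps_const_X_power_mult
      using assms by (simp add: power_add power_int_diff mult_ac divide_inverse)
    then show ?thesis by (simp add: mult_ac)
  qed (simp add: J0)
  have uv: "u * v = fps_X ^ (d * (2 * N + 1))"
  proof -
    have "int (nat (a + b) + d * N + (nat (a - b) + d * N)) = int (d * (2 * N + 1))"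
      using assms(1,2) d by (simp add: abs_le_iff algebra_simps)
    then have "nat (a + b) + d * N + (nat (a - b) + d * N) = d * (2 * N + 1)"
      by linarith
    then show ?thesis
      unfolding u_def v_def fps_const_X_power_mult using assms by (simp only: right_inverse) simp
  qed
  let ?K = "{- int (Suc N)..int (Suc N)}"
  have "qpoch (-c) (nat (a + b)) d (Suc N) * qpoch (- inverse c) (nat (a - b)) d (Suc N) =
      (\<Sum>k\<in>{- int N..int N}. J k * f k) * ((1 + u) * (1 + v))"
    using Suc.IH
    by (simp add: qpoch_Suc J_def f_def d_def u_def v_def mult_ac flip: fps_const_neg)
  also have "(\<Sum>k\<in>{- int N..int N}. J k * f k) * ((1 + u) * (1 + v)) =
      (1 + u * v) * (\<Sum>k\<in>{- int N..int N}. J k * f k) +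
      (\<Sum>k\<in>{- int N..int N}. u * (J k * f k)) + (\<Sum>k\<in>{- int N..int N}. v * (J k * f k))"
    unfolding sum_distrib_left[symmetric] by (simp add: algebra_simps)
  \<comment> \<open>The three sums are brought to the common range \<open>?K\<close> by adding terms
    in which \<open>J\<close> vanishes.\<close>
  also have "(\<Sum>k\<in>{- int N..int N}. J k * f k) = (\<Sum>k\<in>?K. J k * f k)"
    by (rule sum.mono_neutral_left) (auto simp: J0)
  also have "(\<Sum>k\<in>{- int N..int N}. u * (J k * f k)) =
      (\<Sum>k\<in>{- int N..int N}. fps_X ^ (d * nat (int N - k)) * J k * f (k + 1))"
    by (simp only: uf)
  also have "\<dots> = (\<Sum>k\<in>{- int N + 1..int N + 1}. fps_X ^ (d * nat (int N - k + 1)) * J (k - 1) * f k)"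
    by (rule sum.reindex_bij_witness[of _ "\<lambda>k. k - 1" "\<lambda>k. k + 1"]) auto
  also have "\<dots> = (\<Sum>k\<in>?K. fps_X ^ (d * nat (int N - k + 1)) * J (k - 1) * f k)"
    by (rule sum.mono_neutral_left) (auto simp: J0)
  also have "(\<Sum>k\<in>{- int N..int N}. v * (J k * f k)) =
      (\<Sum>k\<in>{- int N..int N}. fps_X ^ (d * nat (int N + k)) * J k * f (k - 1))"
    by (simp only: vf)
  also have "\<dots> = (\<Sum>k\<in>{- int N - 1..int N - 1}. fps_X ^ (d * nat (int N + k + 1)) * J (k + 1) * f k)"
    by (rule sum.reindex_bij_witness[of _ "\<lambda>k. k + 1" "\<lambda>k. k - 1"]) auto
  also have "\<dots> = (\<Sum>k\<in>?K. fps_X ^ (d * nat (int N + k + 1)) * J (k + 1) * f k)"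
    by (rule sum.mono_neutral_left) (auto simp: J0)
  also have "(1 + u * v) * (\<Sum>k\<in>?K. J k * f k) +
      (\<Sum>k\<in>?K. fps_X ^ (d * nat (int N - k + 1)) * J (k - 1) * f k) +
      (\<Sum>k\<in>?K. fps_X ^ (d * nat (int N + k + 1)) * J (k + 1) * f k) =
      (\<Sum>k\<in>?K. jacobi_coeff d (Suc N) k * f k)"
    unfolding sum_distrib_left sum.distrib[symmetric] uv
  proof (rule sum.cong)
    fix k assume "k \<in> ?K"
    then have "\<bar>k\<bar> \<le> int (Suc N)" by auto
    note Suc_N = jacobi_coeff_Suc[OF d(1) this]
    show "(1 + fps_X ^ (d * (2 * N + 1))) * (J k * f k) +
         fps_X ^ (d * nat (int N - k + 1)) * J (k - 1) * f k +
         fps_X ^ (d * nat (int N + k + 1)) * J (k + 1) * f k =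
         jacobi_coeff d (Suc N) k * f k"
      unfolding J_def Suc_N by (simp only: distrib_right mult.assoc)
  qed simp
  finally show ?case by (simp only: f_def d_def)
qed

section \<open>Passage to the limit in the triple product\<close>

lemma fps_mult_nth_cong:
  assumes "\<And>i. i \<le> n \<Longrightarrow> fps_nth f i = fps_nth f' i" "\<And>i. i \<le> n \<Longrightarrow> fps_nth g i = fps_nth g' i"
  shows "fps_nth (f * g) n = fps_nth (f' * g') n"
  unfolding fps_mult_nth using assms by (intro sum.cong) auto

text \<open>Up to degree m every finite product of length at least m agrees with the infinite one,
  so numerator and denominator of the Gaussian binomial cancel after multiplication by (q^d;
  q^d)_inf.\<close>

lemma jacobi_coeff_limit:
  assumes "d > 0" "int m + \<bar>k\<bar> \<le> int N" "i \<le> m"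
  shows "fps_nth (qpoch_inf 1 d d * jacobi_coeff d N k) i = fps_nth (1 :: 'a::field fps) i"
proof -
  define x y where "x = nat (int N - k)" and "y = nat (int N + k)"
  define g :: "nat \<Rightarrow> 'a fps" where "g = qpoch 1 d d"
  have g_inf: "fps_nth (qpoch_inf 1 d d) l = fps_nth (g n) l" if "l \<le> m" "m \<le> n" for l n
    unfolding g_def
  proof (rule qpoch_inf_nth)
    show "l < d + d * n" using assms(1) that by (cases d) auto
  qed fact
  have xy: "m \<le> x" "m \<le> y" "m \<le> 2 * N" "int N - k \<ge> 0" "int N + k \<ge> 0"
    using assms by (auto simp: x_def y_def)
  have inv: "g n * inverse (g n) = 1" for n
    using assms by (intro inverse_mult_eq_1') (simp add: g_def qpoch_nth_0)
  have "fps_nth (qpoch_inf 1 d d * jacobi_coeff d N k) i =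
      fps_nth ((qpoch_inf 1 d d * g (2 * N)) * (inverse (g x) * inverse (g y))) i"
    using xy by (simp add: jacobi_coeff_def qpoch_recip_def x_def y_def g_def mult_ac)
  \<comment> \<open>The infinite product is traded for \<open>g x\<close> and
    \<open>g (2 * N)\<close> for \<open>g y\<close>, which match the two inverses.\<close>
  also have "\<dots> = fps_nth ((g x * g y) * (inverse (g x) * inverse (g y))) i"
  proof (intro fps_mult_nth_cong)
    show "fps_nth (qpoch_inf 1 d d) l = fps_nth (g x) l" if "j \<le> i" "l \<le> j" for j l
      using that assms(3) xy by (intro g_inf) auto
    show "fps_nth (g (2 * N)) l = fps_nth (g y) l" if "j \<le> i" "l \<le> j" for j l
      using that assms(3) xy g_inf[of l "2 * N"] g_inf[of l y] by auto
  qed auto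
  also have "(g x * g y) * (inverse (g x) * inverse (g y)) = (g x * inverse (g x)) * (g y * inverse (g y))"
    by (simp only: mult_ac)
  finally show ?thesis by (simp add: inv)
qed

text \<open>The classical product with base q^a and variable z = c q^b. The finite form is
  multiplied by (q^(2a); q^(2a))_inf, which sends each coefficient to 1 as N grows.\<close>

theorem jacobi_triple_product:
  fixes c :: "'a::field"
  assumes "a > 0" "\<bar>b\<bar> \<le> a" "c \<noteq> 0"
  shows "theta c a b = qpoch_inf 1 (nat (2 * a)) (nat (2 * a)) *
    (qpoch_inf (-c) (nat (a + b)) (nat (2 * a)) * qpoch_inf (- inverse c) (nat (a - b)) (nat (2 * a)))"
proof (rule LIMSEQ_unique)
  define d where "d = nat (2 * a)"
  have d: "d > 0" using assms by (simp add: d_def)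
  define P where "P = (\<lambda>N. qpoch (-c) (nat (a + b)) d N * qpoch (- inverse c) (nat (a - b)) d N)"
  show "(\<lambda>N. qpoch_inf 1 (nat (2 * a)) (nat (2 * a)) * P N) \<longlonglongrightarrow>
    qpoch_inf 1 (nat (2 * a)) (nat (2 * a)) *
    (qpoch_inf (-c) (nat (a + b)) (nat (2 * a)) * qpoch_inf (- inverse c) (nat (a - b)) (nat (2 * a)))"
    using d unfolding P_def d_def
    by (intro tendsto_mult_fps tendsto_const qpoch_tendsto)
  show "(\<lambda>N. qpoch_inf 1 (nat (2 * a)) (nat (2 * a)) * P N) \<longlonglongrightarrow> theta c a b"
  proof (rule tendsto_fpsI)
    fix m
    define e where "e = (\<lambda>k. nat (a * k^2 + b * k))"
    show "\<forall>\<^sub>F N in sequentially.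
        fps_nth (qpoch_inf 1 (nat (2 * a)) (nat (2 * a)) * P N) m = fps_nth (theta c a b) m"
      \<comment> \<open>Only |k| <= m + 1 can contribute to coefficient m, and
        \<open>jacobi_coeff_limit\<close> requires m + |k| <= N.\<close>
      using eventually_ge_at_top[of "2 * m + 1"]
    proof eventually_elim
      case (elim N)
      have small: "\<bar>k\<bar> \<le> int m + 1" if "e k \<le> m" for k
        using theta_exponent_ge[OF assms(1,2), of k] that by (simp add: e_def)
      have coeff: "fps_nth (qpoch_inf 1 d d * jacobi_coeff d N k *
          (fps_const (c powi k) * fps_X ^ e k)) m = (if e k = m then c powi k else 0)" for k
      proof (cases "e k \<le> m")
        case True
        then have "int m + \<bar>k\<bar> \<le> int N"
          using small[OF True] elim by linarith
        then have "fps_nth (qpoch_inf 1 d d * jacobi_coeff d N k *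
            (fps_const (c powi k) * fps_X ^ e k)) m =
            fps_nth (1 * (fps_const (c powi k) * fps_X ^ e k)) m"
          by (intro fps_mult_nth_cong jacobi_coeff_limit[of d m]) (auto simp: d)
        then show ?thesis by simp
      next
        case False
        then show ?thesis
          by (simp add: mult.assoc[symmetric] fps_X_power_mult_right_nth)
      qed
      have "qpoch_inf 1 d d * P N = (\<Sum>k\<in>{- int N..int N}.
          qpoch_inf 1 d d * jacobi_coeff d N k * (fps_const (c powi k) * fps_X ^ e k))"
        unfolding P_def d_def e_def finite_jacobi_triple_product[OF assms]
        by (simp add: sum_distrib_left mult.assoc)
      then have "fps_nth (qpoch_inf 1 d d * P N) m =
          (\<Sum>k\<in>{- int N..int N}. if e k = m then c powi k else 0)"
        by (simp only: fps_sum_nth coeff)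
      also have "\<dots> = (\<Sum>k | k \<in> {- int N..int N} \<and> e k = m. c powi k)"
        by (subst sum.inter_filter) auto
      also have "{k. k \<in> {- int N..int N} \<and> e k = m} = {k. e k = m}"
        using small elim by (force simp: abs_le_iff)
      finally show ?case
        by (simp add: theta_def wsum_def e_def d_def)
    qed
  qed
qed

section \<open>Dissections of Euler products\<close>

text \<open>E(q^k) over an arbitrary field, so that the same notation serves rational and complex
  coefficients.\<close>

abbreviation euler :: "nat \<Rightarrow> 'a::field fps" where
  "euler k \<equiv> qpoch_inf 1 k k"

lemma euler_split: "k > 0 \<Longrightarrow> euler k = qpoch_inf 1 k (2 * k) * euler (2 * k)"
  using qpoch_inf_split2[of k 1 k] by (simp add: mult_2)

text \<open>The sign \<open>c = 1\<close> gives 1 + w and \<open>c = -1\<close> gives 1 - w, where w is \<open>omega\<close> below.\<close>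
lemma euler_dissection_aux:
  fixes c :: "'a::field"
  assumes "c^2 = 1"
  shows "euler 6 * qpoch_inf c 3 6 ^ 2 * (euler 6 * (qpoch_inf (-c) 1 6 * qpoch_inf (-c) 5 6)) =
    euler 4 ^ 2 + fps_const c * fps_X * (euler 12 * (qpoch_inf 1 2 12 * qpoch_inf 1 10 12)) ^ 2"
proof -
  have c: "c = 1 \<or> c = -1" using assms by (simp add: power2_eq_1_iff)
  have "theta (-c) 3 0 * theta c 3 2 =
      theta (-1) 6 2 * theta (-1) 6 (-2) + fps_const c * fps_X * (theta (-1) 6 4 * theta (-1) 6 4)"
    using theta_mult[of 3 0 2 "-c" c] c by auto
  moreover have "theta (-c) 3 0 = euler 6 * qpoch_inf c 3 6 ^ 2"
    using c by (subst jacobi_triple_product) (auto simp: power2_eq_square)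
  moreover have "theta c 3 2 = euler 6 * (qpoch_inf (-c) 1 6 * qpoch_inf (-c) 5 6)"
    using c by (subst jacobi_triple_product) (auto simp: mult_ac)
  \<comment> \<open>Splitting E(q^4) modulo 12 shows that both theta series of the even part equal
    E(q^4).\<close>
  moreover have "euler 4 = qpoch_inf 1 4 12 * qpoch_inf 1 8 12 * (euler 12 :: 'a fps)"
    using qpoch_inf_split3[of 4 "1::'a" 4] by simp
  moreover have "theta (-1) 6 2 = euler 12 * (qpoch_inf 1 4 12 * (qpoch_inf 1 8 12 :: 'a fps))"
    "theta (-1) 6 (-2) = euler 12 * (qpoch_inf 1 4 12 * (qpoch_inf 1 8 12 :: 'a fps))"
    "theta (-1) 6 4 = euler 12 * (qpoch_inf 1 2 12 * (qpoch_inf 1 10 12 :: 'a fps))"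
    by (subst jacobi_triple_product; simp add: mult_ac)+
  ultimately show ?thesis by (simp add: power2_eq_square mult_ac)
qed

text \<open>Turns the product in the odd part into Euler products: (q^2; q^4) is split modulo 12,
  and its middle factor (q^6; q^12) completes E(q^12) to E(q^6).\<close>

lemma euler_2_12: "euler 2 * euler 12 =
  qpoch_inf 1 2 12 * qpoch_inf 1 10 12 * euler 4 * (euler 6 :: 'a::field fps)"
  using euler_split[of 2, where 'a = 'a] euler_split[of 6, where 'a = 'a]
    qpoch_inf_split3[of 4 "1::'a" 2] by (simp add: mult_ac)

text \<open>The 2-dissection E(q^3)^3/E(q) = E(q^4)^3 E(q^6)^2/(E(q^2)^2 E(q^12)) + q
  E(q^12)^3/E(q^4), cleared of denominators.\<close>

lemma euler_dissection_plus:
  "euler 3 ^ 3 * euler 2 ^ 2 * euler 12 * euler 4 =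
    euler 1 * (euler 4 ^ 4 * euler 6 ^ 2 + fps_X * euler 2 ^ 2 * euler 12 ^ 4 :: 'a::field fps)"
proof -
  define O1 where "O1 = (qpoch_inf 1 1 2 :: 'a fps)"
  define O3 where "O3 = (qpoch_inf 1 3 6 :: 'a fps)"
  define O3' where "O3' = (qpoch_inf (-1) 3 6 :: 'a fps)"
  define y where "y = qpoch_inf (-1) 1 6 * (qpoch_inf (-1) 5 6 :: 'a fps)"
  define a where "a = qpoch_inf 1 2 12 * (qpoch_inf 1 10 12 :: 'a fps)"
  have E1: "euler 1 = O1 * (euler 2 :: 'a fps)" and E3: "euler 3 = O3 * (euler 6 :: 'a fps)"
    using euler_split[of 1, where 'a = 'a] euler_split[of 3, where 'a = 'a]
    by (simp_all add: O1_def O3_def del: One_nat_def)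
  have E: "euler 2 * euler 12 = a * euler 4 * (euler 6 :: 'a fps)"
    by (simp add: a_def euler_2_12)
  have "O3' \<noteq> 0" by (simp add: O3'_def qpoch_inf_neq_0)
  \<comment> \<open>\<open>O3'\<close> completes \<open>y\<close> to (-q; q^2), and (q; q^2)(-q;
    q^2) = (q^2; q^4). Being nonzero, it can be cancelled afterwards.\<close>
  moreover have "O1 * (y * O3') = a * (O3 * O3')"
    using qpoch_inf_neg[of 2 "1::'a" 1] qpoch_inf_neg[of 6 "1::'a" 3]
      qpoch_inf_split3[of 2 "-1::'a" 1] qpoch_inf_split3[of 4 "1::'a" 2]
    by (simp add: O1_def O3_def O3'_def y_def a_def mult_ac del: One_nat_def)
  ultimately have O1: "O1 * y = a * O3" by (simp add: mult_ac)
  have "euler 6 * O3 ^ 2 * (euler 6 * y) = euler 4 ^ 2 + fps_X * (euler 12 * a) ^ 2"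
    using euler_dissection_aux[of "1::'a"] by (simp add: O3_def y_def a_def)
  then show ?thesis unfolding E1 E3 using E O1 by algebra
qed

text \<open>The preceding dissection with -q in place of q, where E(-q) = E(q^2)^3/(E(q)
  E(q^4)).\<close>

lemma euler_dissection_minus:
  "euler 1 * euler 6 ^ 9 * euler 4 ^ 2 = euler 2 * euler 3 ^ 3 * euler 12 ^ 2 *
    (euler 4 ^ 4 * euler 6 ^ 2 - fps_X * euler 2 ^ 2 * euler 12 ^ 4 :: 'a::field fps)"
proof -
  define O1 where "O1 = (qpoch_inf 1 1 2 :: 'a fps)"
  define O3 where "O3 = (qpoch_inf 1 3 6 :: 'a fps)"
  define O3' where "O3' = (qpoch_inf (-1) 3 6 :: 'a fps)"
  define x where "x = qpoch_inf 1 1 6 * (qpoch_inf 1 5 6 :: 'a fps)"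
  define a where "a = qpoch_inf 1 2 12 * (qpoch_inf 1 10 12 :: 'a fps)"
  have E1: "euler 1 = O1 * (euler 2 :: 'a fps)" and E3: "euler 3 = O3 * (euler 6 :: 'a fps)"
    using euler_split[of 1, where 'a = 'a] euler_split[of 3, where 'a = 'a]
    by (simp_all add: O1_def O3_def del: One_nat_def)
  have E: "euler 2 * euler 12 = a * euler 4 * (euler 6 :: 'a fps)"
    by (simp add: a_def euler_2_12)
  have O1: "O1 = x * O3"
    using qpoch_inf_split3[of 2 "1::'a" 1] by (simp add: O1_def O3_def x_def mult_ac del: One_nat_def)
  have E6: "euler 6 = O3 * O3' * (euler 12 :: 'a fps)"
    using euler_split[of 6, where 'a = 'a] qpoch_inf_neg[of 6 "1::'a" 3]
    by (simp add: O3_def O3'_def)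
  have "euler 6 * O3' ^ 2 * (euler 6 * x) = euler 4 ^ 2 - fps_X * (euler 12 * a) ^ 2"
    using euler_dissection_aux[of "-1::'a"] by (simp add: O3'_def x_def a_def flip: fps_const_neg)
  then have "euler 4 ^ 4 * euler 6 ^ 2 - fps_X * euler 2 ^ 2 * euler 12 ^ 4 =
      euler 6 ^ 2 * euler 4 ^ 2 * (euler 6 * O3' ^ 2 * (euler 6 * x))"
    using E by algebra
  then show ?thesis unfolding E1 E3 O1 using E6 by algebra
qed

text \<open>The coefficient 3 arises as \<open>- w^2 * (1 - w)^2\<close>.\<close>
lemma euler_dissection_cubic_aux:
  fixes w :: "'a::field"
  assumes w: "1 + w + w^2 = 0"
  shows "euler 2 ^ 9 * euler 3 * euler 12 ^ 2 = euler 1 ^ 3 * euler 4 ^ 2 * euler 6 *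
    (euler 4 ^ 4 * euler 6 ^ 2 + 3 * fps_X * euler 2 ^ 2 * euler 12 ^ 4 :: 'a fps)"
proof -
  define O1 where "O1 = (qpoch_inf 1 1 2 :: 'a fps)"
  define O1' where "O1' = (qpoch_inf (-1) 1 2 :: 'a fps)"
  define O3 where "O3 = (qpoch_inf 1 3 6 :: 'a fps)"
  define z where "z = qpoch_inf w 1 2 * qpoch_inf (w^2) 1 2"
  define t where "t = qpoch_inf w 2 4 * qpoch_inf (w^2) 2 4"
  define b g where "b = (qpoch_inf 1 2 4 :: 'a fps)" and "g = (qpoch_inf 1 6 12 :: 'a fps)"
  have w3: "w * w^2 = 1" using w by algebra
  then have w0: "w \<noteq> 0" "inverse w = w^2" by (auto intro: inverse_unique)
  then have w1: "inverse (w^2) = w" by (metis inverse_inverse_eq)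
  have E1: "euler 1 = O1 * (euler 2 :: 'a fps)" and E3: "euler 3 = O3 * (euler 6 :: 'a fps)"
    and E2: "euler 2 = b * (euler 4 :: 'a fps)" and E6: "euler 6 = g * (euler 12 :: 'a fps)"
    using euler_split[of 1, where 'a = 'a] euler_split[of 3, where 'a = 'a]
      euler_split[of 2, where 'a = 'a] euler_split[of 6, where 'a = 'a]
    by (simp_all add: O1_def O3_def b_def g_def del: One_nat_def)
  have O: "O1 * O1' = b"
    using qpoch_inf_neg[of 2 "1::'a" 1] by (simp add: O1_def O1'_def b_def)
  have z: "O1 * z = O3"
    using qpoch_inf_cube_roots[OF w, of 2 1] by (simp add: O1_def z_def O3_def mult_ac)
  have t: "b * t = g"
    using qpoch_inf_cube_roots[OF w, of 4 2] by (simp add: b_def t_def g_def mult_ac)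
  have E12: "euler 4 * qpoch_inf w 4 4 * qpoch_inf (w^2) 4 4 = euler 12"
    using qpoch_inf_cube_roots[OF w, of 4 4] by simp
  have "theta 1 1 0 = euler 2 * O1' ^ 2"
    by (subst jacobi_triple_product) (auto simp: O1'_def power2_eq_square)
  moreover have "theta (-w) 1 0 = euler 2 * z"
    using w0 by (subst jacobi_triple_product) (auto simp: z_def)
  moreover have "theta (-w) 2 0 = euler 4 * t" "theta (-(w^2)) 2 0 = euler 4 * t"
    using w0 w1 by (subst jacobi_triple_product; simp add: t_def mult_ac)+
  \<comment> \<open>One product starts at exponent 0 and contributes the constant 1 - w; the
    remaining three combine to E(q^12).\<close>
  moreover have "theta (-(w^2)) 2 2 = fps_const (1 - w) * euler 12"
    using w0 w1 E12 by (subst jacobi_triple_product) (simp_all add: qpoch_inf_0 mult_ac)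
  moreover have "theta 1 1 0 * theta (-w) 1 0 = theta (-w) 2 0 * theta (-(w^2)) 2 0 +
      fps_const (- (w^2)) * fps_X * (theta (-(w^2)) 2 2 * theta (-(w^2)) 2 2)"
    using theta_mult[of 1 0 0 1 "-w"] w0 by (simp add: divide_inverse)
  ultimately have "euler 2 * O1' ^ 2 * (euler 2 * z) = (euler 4 * t) ^ 2 +
      (fps_const (- (w^2)) * fps_const (1 - w) ^ 2) * fps_X * euler 12 ^ 2"
    by (simp only: power2_eq_square mult_ac)
  moreover have "- (w^2) * (1 - w)^2 = 3"
    using w by algebra
  then have "fps_const (- (w^2)) * fps_const (1 - w) ^ 2 = (3 :: 'a fps)"
    by (simp only: fps_const_power fps_const_mult numeral_fps_const)
  ultimately have main: "euler 2 * O1' ^ 2 * (euler 2 * z) = (euler 4 * t) ^ 2 + 3 * fps_X * euler 12 ^ 2"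
    by simp
  \<comment> \<open>Here t = E(q^4) E(q^6)/(E(q^2) E(q^12)), so the even part becomes an Euler
    quotient.\<close>
  have "euler 4 ^ 4 * euler 6 ^ 2 + 3 * fps_X * euler 2 ^ 2 * euler 12 ^ 4 =
      euler 2 ^ 2 * euler 12 ^ 2 * ((euler 4 * t) ^ 2 + 3 * fps_X * euler 12 ^ 2)"
    using E2 E6 t by algebra
  also have "\<dots> = euler 2 ^ 2 * euler 12 ^ 2 * (euler 2 * O1' ^ 2 * (euler 2 * z))"
    by (simp only: main)
  finally show ?thesis
    unfolding E1 E3 using O z E2 by algebra
qed

section \<open>Descent from complex to rational coefficients\<close>

definition fps_of_rat :: "rat fps \<Rightarrow> 'a::field_char_0 fps" where
  "fps_of_rat f = Abs_fps (\<lambda>n. of_rat (fps_nth f n))"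

lemma fps_of_rat_simps:
  "fps_of_rat (f + g) = fps_of_rat f + fps_of_rat g"
  "fps_of_rat (f - g) = fps_of_rat f - fps_of_rat g"
  "fps_of_rat (f * g) = fps_of_rat f * fps_of_rat g"
  "fps_of_rat 1 = 1" "fps_of_rat fps_X = fps_X" "fps_of_rat (numeral n) = numeral n"
  by (auto simp: fps_eq_iff fps_of_rat_def fps_mult_nth of_rat_add of_rat_diff of_rat_mult
      of_rat_sum fps_numeral_nth fps_X_def)

lemma fps_of_rat_power: "fps_of_rat (f ^ n) = fps_of_rat f ^ n"
  by (induction n) (simp_all add: fps_of_rat_simps)

lemma fps_of_rat_eq_iff: "fps_of_rat f = fps_of_rat g \<longleftrightarrow> f = g"
  by (simp add: fps_eq_iff fps_of_rat_def)

lemma fps_of_rat_qpoch_inf: "fps_of_rat (qpoch_inf 1 k d) = qpoch_inf 1 k d"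
proof -
  have "fps_of_rat (qpoch 1 k d n) = (qpoch 1 k d n :: 'a fps)" for n
    by (induction n) (simp_all add: qpoch_def fps_of_rat_simps fps_of_rat_power)
  then show ?thesis
    by (simp add: fps_eq_iff qpoch_inf_def fps_of_rat_def)
qed

text \<open>With -q in place of q this is the 2-dissection of E(q)^3/E(q^3). A primitive cube root
  of unity exists over the complex numbers, and the injective map \<open>fps_of_rat\<close> brings
  the identity back.\<close>

lemma euler_dissection_cubic:
  "euler 2 ^ 9 * euler 3 * euler 12 ^ 2 = euler 1 ^ 3 * euler 4 ^ 2 * euler 6 *
    (euler 4 ^ 4 * euler 6 ^ 2 + 3 * fps_X * euler 2 ^ 2 * euler 12 ^ 4 :: rat fps)"
proof -
  have "1 + Complex (-1/2) (sqrt 3 / 2) + Complex (-1/2) (sqrt 3 / 2) ^ 2 = 0"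
    by (simp add: complex_eq_iff power2_eq_square)
  from euler_dissection_cubic_aux[OF this] show ?thesis
    by (subst fps_of_rat_eq_iff[where 'a = complex, symmetric])
      (simp only: fps_of_rat_simps fps_of_rat_power fps_of_rat_qpoch_inf)
qed

lemma qsub_simps:
  assumes "k > 0"
  shows "qsub k (f + g) = qsub k f + qsub k g" "qsub k (f - g) = qsub k f - qsub k g"
    "qsub k (f * g) = qsub k f * qsub k g" "qsub k (f ^ n) = qsub k f ^ n"
    "qsub k 1 = 1" "qsub k (numeral m) = numeral m" "qsub k fps_X = fps_X ^ k"
  using assms
  by (simp_all add: qsub_def fps_compose_add_distrib fps_compose_sub_distrib
      fps_compose_mult_distrib fps_compose_power[symmetric] numeral_fps_const)

text \<open>Coefficient n of the substituted series uses only coefficients up to n of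
  \<open>Eul\<close>, and all of these can be read off one product with n factors, where
  substitution acts factor by factor.\<close>

lemma qsub_Eul:
  assumes "k > 0"
  shows "qsub k Eul = euler k"
proof (rule fps_ext)
  fix n
  have Eul: "fps_nth Eul i = fps_nth (qpoch 1 1 1 n) i" if "i \<le> n" for i
  proof -
    have "(\<Prod>m\<in>{1..i}. 1 - fps_X ^ m) = (qpoch 1 1 1 i :: rat fps)"
      unfolding qpoch_def
      by (rule prod.reindex_bij_witness[of _ "\<lambda>m. Suc m" "\<lambda>m. m - 1"]) auto
    then show ?thesis
      using qpoch_nth_stable[of i 1 1 i n "1::rat"] that by (simp add: Eul_def)
  qed
  have X: "fps_nth (fps_X ^ k) 0 = (0 :: rat)" using assms by simp
  have "fps_nth (qsub k Eul) n = fps_nth (qpoch 1 1 1 n oo fps_X ^ k) n"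
    by (simp add: qsub_def fps_compose_nth Eul)
  also have "qpoch 1 1 1 n oo fps_X ^ k = (qpoch 1 k k n :: rat fps)"
    by (simp add: qpoch_def fps_compose_prod_distrib[OF X] fps_compose_sub_distrib
        fps_compose_mult_distrib[OF X] fps_X_power_compose power_mult[symmetric] power_add
        assms)
  also have "fps_nth \<dots> n = fps_nth (euler k) n"
    using assms by (intro qpoch_inf_nth[symmetric]) (auto, cases k, auto)
  finally show "fps_nth (qsub k Eul) n = fps_nth (euler k) n" .
qed

section \<open>The operator U\<close>

text \<open>The first summand has only even powers and the second only odd ones, so a decomposition
  of this shape determines the value of U.\<close>

lemma Uop_even_odd: "Uop (qsub 2 f + fps_X * qsub 2 g) = f"
proof (rule fps_ext)
  fix n
  have "fps_nth (qsub 2 h) m = (if even m then fps_nth h (m div 2) else 0)" for h m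
  proof -
    have "fps_nth (qsub 2 h) m = (\<Sum>i=0..m. if m = 2 * i then fps_nth h i else 0)"
      unfolding qsub_def fps_compose_nth
      by (intro sum.cong) (auto simp flip: power_mult)
    also have "\<dots> = (if even m then fps_nth h (m div 2) else 0)"
    proof (cases "even m")
      case False
      then show ?thesis by (auto intro!: sum.neutral)
    qed (auto simp: sum.delta elim!: evenE)
    finally show ?thesis .
  qed
  then show "fps_nth (Uop (qsub 2 f + fps_X * qsub 2 g)) n = fps_nth f n"
    by (simp add: Uop_def)
qed

text \<open>The series r(q) = psi(q^3)^2/psi(q)^2, rewritten with psi(q) = E(q^2)^2/E(q).\<close>

definition psi_ratio :: "rat fps" where
  "psi_ratio = euler 1 ^ 2 * euler 6 ^ 4 / (euler 2 ^ 4 * euler 3 ^ 2)"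

lemma euler_nth_0: "k > 0 \<Longrightarrow> fps_nth (euler k) 0 = 1"
  by (subst qpoch_inf_nth[of _ _ _ 0]) (simp_all add: qpoch_def)

lemma qsub_euler:
  assumes "k > 0" "j > 0"
  shows "qsub k (euler j) = euler (k * j)"
proof -
  have "qsub k (qsub j Eul) = qsub (k * j) Eul"
    using assms by (simp add: qsub_def fps_compose_assoc[symmetric] fps_X_power_compose mult.commute
        flip: power_mult)
  then show ?thesis using assms by (simp add: qsub_Eul)
qed

text \<open>The quotients are exact because every denominator has constant term 1 and is a
  unit.\<close>

lemma xi_mult: "xi * (euler 1 * euler 3 ^ 5) = euler 2 ^ 5 * euler 6"
  and gam_mult: "gam * euler 3 ^ 15 = euler 1 ^ 5 * euler 2 ^ 5 * euler 6 ^ 5"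
  and psi_ratio_mult: "psi_ratio * (euler 2 ^ 4 * euler 3 ^ 2) = euler 1 ^ 2 * euler 6 ^ 4"
proof -
  have Eul: "Eul = euler 1"
    using qsub_Eul[of 1] by (simp add: qsub_def)
  have "is_unit (euler 1 * euler 3 ^ 5 :: rat fps)" "is_unit (euler 3 ^ 15 :: rat fps)"
    "is_unit (euler 2 ^ 4 * euler 3 ^ 2 :: rat fps)"
    by (simp_all add: euler_nth_0 del: One_nat_def)
  then show "xi * (euler 1 * euler 3 ^ 5) = euler 2 ^ 5 * euler 6"
    "gam * euler 3 ^ 15 = euler 1 ^ 5 * euler 2 ^ 5 * euler 6 ^ 5"
    "psi_ratio * (euler 2 ^ 4 * euler 3 ^ 2) = euler 1 ^ 2 * euler 6 ^ 4"
    unfolding xi_def gam_def psi_ratio_def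
    by (simp_all only: qsub_Eul zero_less_numeral, simp_all only: Eul dvd_div_mult_self unit_imp_dvd)
qed

definition omega :: "rat fps" where
  "omega = fps_X * qsub 2 psi_ratio"

text \<open>Thus w is the ratio of odd to even part in the first dissection, and the same ratio
  occurs in the other two with factors -1 and 3.\<close>

lemma omega_mult: "omega * (euler 4 ^ 4 * euler 6 ^ 2) = fps_X * euler 2 ^ 2 * euler 12 ^ 4"
  using arg_cong[OF psi_ratio_mult, of "qsub 2"]
  by (simp add: omega_def qsub_simps qsub_euler mult.assoc)

text \<open>The dissections make 1 + w, 1 - w and 1 + 3w Euler quotients, which reduces each claim
  to comparing exponents.\<close>

lemma xi_omega: "xi * (1 + omega) ^ 2 = 1 + 3 * omega"
  and qsub_xi_omega: "qsub 2 xi * (1 - omega ^ 2) = 1"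
  and kap_omega: "kap = qsub 2 xi ^ 5 * (1 + omega) ^ 5"
proof -
  \<comment> \<open>From here on the Euler products act as indeterminates subject only to the
    relations listed and to being nonzero.\<close>
  obtain E1 E2 E3 E4 E6 E12 :: "rat fps" where
    E: "E1 = euler 1" "E2 = euler 2" "E3 = euler 3" "E4 = euler 4" "E6 = euler 6" "E12 = euler 12"
    by blast
  have nz: "E1 \<noteq> 0" "E2 \<noteq> 0" "E3 \<noteq> 0" "E4 \<noteq> 0" "E6 \<noteq> 0" "E12 \<noteq> 0"
    by (simp_all add: E qpoch_inf_neq_0)
  \<comment> \<open>\<open>u\<close> is the denominator of w.\<close>
  define u where "u = E4 ^ 4 * E6 ^ 2"
  have plus: "E1 * u * (1 + omega) = E3 ^ 3 * E2 ^ 2 * E12 * E4"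
    using euler_dissection_plus[where 'a = rat] omega_mult unfolding E[symmetric] u_def by algebra
  have minus: "E2 * E3 ^ 3 * E12 ^ 2 * u * (1 - omega) = E1 * E6 ^ 9 * E4 ^ 2"
    using euler_dissection_minus[where 'a = rat] omega_mult unfolding E[symmetric] u_def by algebra
  have cubic: "E1 ^ 3 * E4 ^ 2 * E6 * u * (1 + 3 * omega) = E2 ^ 9 * E3 * E12 ^ 2"
    using euler_dissection_cubic omega_mult unfolding E[symmetric] u_def by algebra
  have xi: "xi * (E1 * E3 ^ 5) = E2 ^ 5 * E6"
    using xi_mult by (simp only: E)
  have xi2: "qsub 2 xi * (E2 * E6 ^ 5) = E4 ^ 5 * E12"
    using arg_cong[OF xi_mult, of "qsub 2"] by (simp add: E qsub_simps qsub_euler)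
  have gam: "gam * E3 ^ 15 = E1 ^ 5 * E2 ^ 5 * E6 ^ 5"
    using gam_mult by (simp only: E)
  have gam2: "qsub 2 gam * E6 ^ 15 = E2 ^ 5 * E4 ^ 5 * E12 ^ 5"
    using arg_cong[OF gam_mult, of "qsub 2"] by (simp add: E qsub_simps qsub_euler)
  \<comment> \<open>The claim is multiplied by all denominators of xi and of the powers of 1 + w and
    1 + 3w; their product is nonzero and cancels at the end. The other two claims follow the same
    pattern.\<close>
  have "E1 ^ 3 * E4 ^ 2 * E6 * u * (E1 * E3 ^ 5) * (E1 * u) ^ 2 * (xi * (1 + omega) ^ 2) =
      E1 ^ 3 * E4 ^ 2 * E6 * u * (xi * (E1 * E3 ^ 5)) * (E1 * u * (1 + omega)) ^ 2"
    by algebra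
  also have "\<dots> = (E1 * E3 ^ 5) * (E1 * u) ^ 2 * (E1 ^ 3 * E4 ^ 2 * E6 * u * (1 + 3 * omega))"
    unfolding xi plus cubic unfolding u_def by algebra
  finally have "E1 ^ 3 * E4 ^ 2 * E6 * u * (E1 * E3 ^ 5) * (E1 * u) ^ 2 * (xi * (1 + omega) ^ 2) =
      E1 ^ 3 * E4 ^ 2 * E6 * u * (E1 * E3 ^ 5) * (E1 * u) ^ 2 * (1 + 3 * omega)"
    by (simp only: mult_ac)
  then show "xi * (1 + omega) ^ 2 = 1 + 3 * omega"
    using nz by (simp add: u_def)
  have "(E2 * E6 ^ 5) * (E1 * u) * (E2 * E3 ^ 3 * E12 ^ 2 * u) * (qsub 2 xi * (1 - omega ^ 2)) =
      (qsub 2 xi * (E2 * E6 ^ 5)) * (E1 * u * (1 + omega)) * (E2 * E3 ^ 3 * E12 ^ 2 * u * (1 - omega))"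
    by algebra
  also have "\<dots> = (E2 * E6 ^ 5) * (E1 * u) * (E2 * E3 ^ 3 * E12 ^ 2 * u) * 1"
    unfolding xi2 plus minus unfolding u_def by algebra
  finally show "qsub 2 xi * (1 - omega ^ 2) = 1"
    using nz by (simp add: u_def)
  have "gam \<noteq> 0" using gam nz by auto
  have "(E3 ^ 15 * E6 ^ 30 * (E2 * E6 ^ 5) ^ 5 * (E1 * u) ^ 5) * qsub 2 gam ^ 2 =
      (E3 ^ 15 * (E2 * E6 ^ 5) ^ 5 * (E1 * u) ^ 5) * (qsub 2 gam * E6 ^ 15) ^ 2"
    by (simp add: power_mult_distrib flip: power_mult)
  also have "\<dots> = E6 ^ 30 * (gam * E3 ^ 15) * (qsub 2 xi * (E2 * E6 ^ 5)) ^ 5 * (E1 * u * (1 + omega)) ^ 5"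
    unfolding gam gam2 xi2 plus unfolding u_def
    by (simp add: power_mult_distrib mult_ac flip: power_mult power_add)
  also have "\<dots> = (E3 ^ 15 * E6 ^ 30 * (E2 * E6 ^ 5) ^ 5 * (E1 * u) ^ 5) *
      (gam * (qsub 2 xi ^ 5 * (1 + omega) ^ 5))"
    by (simp only: power_mult_distrib mult_ac)
  finally have "qsub 2 gam ^ 2 = gam * (qsub 2 xi ^ 5 * (1 + omega) ^ 5)"
    using nz by (simp add: u_def)
  then show "kap = qsub 2 xi ^ 5 * (1 + omega) ^ 5"
    using \<open>gam \<noteq> 0\<close> by (simp add: kap_def)
qed

section \<open>The five values of U\<close>

theorem theorem2p3:
  shows "Uop kap = 5 * xi ^ 3 - 20 * xi ^ 4 + 16 * xi ^ 5
    \<and> Uop xi = 5 * xi - 4 * xi ^ 2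
    \<and> Uop (kap ^ 2) = - (xi ^ 5) + 50 * xi ^ 6 - 400 * xi ^ 7 + 1120 * xi ^ 8
                         - 1280 * xi ^ 9 + 512 * xi ^ 10
    \<and> Uop (kap * xi) = 3 * xi ^ 3 - 18 * xi ^ 4 + 16 * xi ^ 5
    \<and> Uop (xi ^ 2) = - 9 * xi + 58 * xi ^ 2 - 80 * xi ^ 3 + 32 * xi ^ 4"
proof -
  define r s y w where "r = psi_ratio" and "s = fps_X * psi_ratio ^ 2" and "y = qsub 2 xi"
    and "w = omega"
  have w: "w = fps_X * qsub 2 r" and ws: "w ^ 2 = qsub 2 s"
    by (simp_all add: w_def r_def s_def omega_def qsub_simps power_mult_distrib)
  note q = qsub_simps[of 2, simplified] y_def[symmetric] ws[symmetric]
  have inv: "y * (1 - w ^ 2) = 1"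
    using qsub_xi_omega by (simp add: y_def w_def)
  have xi_w: "xi * (1 + w) ^ 2 = 1 + 3 * w"
    using xi_omega by (simp add: w_def)
  have kap: "kap = y ^ 5 * (1 + w) ^ 5"
    using kap_omega by (simp add: y_def w_def)
  \<comment> \<open>The inserted factor is the square of y (1 - w)(1 + w) = 1; it makes
    \<open>xi\<close> polynomial in w with the even series y as coefficient.\<close>
  have "xi = xi * (1 + w) ^ 2 * (y * (1 - w)) ^ 2"
    using inv by algebra
  then have xi: "xi = y ^ 2 * (1 + 3 * w) * (1 - w) ^ 2"
    unfolding xi_w by algebra
  \<comment> \<open>Since U undoes the substitution of q^2, the relation between y and w^2 descends
    to one between xi and s.\<close>
  have "qsub 2 (xi * (1 - s)) = qsub 2 1"
    using inv by (simp add: q)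
  then have "xi * (1 - s) = 1"
    using Uop_even_odd[of "xi * (1 - s)" 0] Uop_even_odd[of 1 0] by simp
  \<comment> \<open>This relation eliminates s: xi^n s^j = xi^(n - j) (xi - 1)^j for j <= n.\<close>
  then have s: "xi * s = xi - 1" by algebra
  have Uop: "Uop f = g" if "f = qsub 2 g + w * qsub 2 h" for f g h
    using Uop_even_odd[of g "r * h"] that by (simp add: w qsub_simps mult.assoc)
  \<comment> \<open>The polynomials in s are the even and odd parts of (1 + w)^5 with s for w^2;
    xi^5 comes from y^5. The witnesses below arise likewise.\<close>
  have "Uop kap = xi ^ 5 * (1 + 10 * s + 5 * s ^ 2)"
    by (rule Uop[of _ _ "xi ^ 5 * (5 + 10 * s + s ^ 2)"]) (simp only: q kap, algebra)
  moreover have "xi ^ 5 * (1 + 10 * s + 5 * s ^ 2) = 5 * xi ^ 3 - 20 * xi ^ 4 + 16 * xi ^ 5"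
    using s by algebra
  \<comment> \<open>Here (1 + 3w)(1 - w)^2 = 1 + w - 5w^2 + 3w^3 is split; its square serves for
    \<open>xi ^ 2\<close>.\<close>
  moreover have "Uop xi = xi ^ 2 * (1 - 5 * s)"
    by (rule Uop[of _ _ "xi ^ 2 * (1 + 3 * s)"]) (simp only: q, use xi in algebra)
  moreover have "xi ^ 2 * (1 - 5 * s) = 5 * xi - 4 * xi ^ 2"
    using s by algebra
  moreover have "Uop (kap ^ 2) = xi ^ 10 * (1 + 45 * s + 210 * s ^ 2 + 210 * s ^ 3 + 45 * s ^ 4 + s ^ 5)"
    by (rule Uop[of _ _ "xi ^ 10 * (10 + 120 * s + 252 * s ^ 2 + 120 * s ^ 3 + 10 * s ^ 4)"])
      (simp only: q kap, algebra)
  moreover have "xi ^ 10 * (1 + 45 * s + 210 * s ^ 2 + 210 * s ^ 3 + 45 * s ^ 4 + s ^ 5) =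
      - (xi ^ 5) + 50 * xi ^ 6 - 400 * xi ^ 7 + 1120 * xi ^ 8 - 1280 * xi ^ 9 + 512 * xi ^ 10"
    using s by algebra
  moreover have "Uop (kap * xi) = xi ^ 5 * (1 + 12 * s + 3 * s ^ 2)"
  proof -
    \<comment> \<open>Two of the five factors 1 + w in \<open>kap\<close> absorb the denominator of
      xi, leaving (1 + w)^3 (1 + 3w) = 1 + 6w + 12w^2 + 10w^3 + 3w^4.\<close>
    have "kap * xi = y ^ 5 * (1 + w) ^ 3 * (xi * (1 + w) ^ 2)"
      unfolding kap by algebra
    then have kap_xi: "kap * xi = y ^ 5 * (1 + w) ^ 3 * (1 + 3 * w)"
      unfolding xi_w .
    show ?thesis
      by (rule Uop[of _ _ "xi ^ 5 * (6 + 10 * s)"]) (simp only: q kap_xi, algebra)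
  qed
  moreover have "xi ^ 5 * (1 + 12 * s + 3 * s ^ 2) = 3 * xi ^ 3 - 18 * xi ^ 4 + 16 * xi ^ 5"
    using s by algebra
  moreover have "Uop (xi ^ 2) = xi ^ 4 * (1 - 9 * s + 31 * s ^ 2 + 9 * s ^ 3)"
    by (rule Uop[of _ _ "xi ^ 4 * (2 - 4 * s - 30 * s ^ 2)"]) (simp only: q, use xi in algebra)
  moreover have "xi ^ 4 * (1 - 9 * s + 31 * s ^ 2 + 9 * s ^ 3) =
      - 9 * xi + 58 * xi ^ 2 - 80 * xi ^ 3 + 32 * xi ^ 4"
    using s by algebra
  ultimately show ?thesis by simp
qed

end
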